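(* Let $(\Omega,\Sigma,\mathbf{P})$ be a probability space and let $(X_p)$, $(Y_p)$ be two sequences of complex-valued random variables on $\Omega$, indexed by primes $p$, such that: (i) $(Y_p)$ is an independent sequence of integrable random variables; (ii) for every $x>0$ there is an integrable non-negative random variable $R_X(x)$ such that, almost surely, $$\sum_{\substack{q>x\\ q\text{ squarefree}}}|X_q|\leq R_X(x),$$ and $R_X(x)\to 0$ almost surely as $x\to+\infty$; (iii) the product $\prod_p(1+|\mathbf{E}(Y_p)|)$ converges. Let $Z_X=\prod_p(1+X_p)$ (an almost surely absolutely convergent product). Then for any $x>0$, $$\Bigl|\mathbf{E}(Z_X)-\prod_p(1+\mathbf{E}(Y_p))\Bigr|\leq \mathbf{E}(R_X(x))+\sum_{\substack{q\leq x\\ q\text{ squarefree}}}|\mathbf{E}(X_q-Y_q)|+\sum_{\substack{q>x\\ q\text{ squarefree}}}|\mathbf{E}(Y_q)|.$$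
   Context: For a squarefree integer $q\geq 1$, $X_q=\prod_{p\mid q}X_p$ and $Y_q=\prod_{p\mid q}Y_p$ (so $X_1=Y_1=1$). $\mathbf{E}$ denotes expectation. All products indexed by $p$ are over primes. *)

theory Defs
  imports "HOL-Probability.Probability" "HOL-Computational_Algebra.Squarefree"
begin

text \<open>
  Infinite products over the primes are infinite products over all naturals whose factors at
  non-primes are set to 1, so the partial products are those over the primes up to a bound.
\<close>

definition on_primes :: "(nat \<Rightarrow> 'b::one) \<Rightarrow> nat \<Rightarrow> 'b" where
  "on_primes f n = (if prime n then f n else 1)"

text \<open>Meant for squarefree \<open>q\<close>; only the values of \<open>X\<close> at primes matter.\<close>

definition sqfree_ext :: "(nat \<Rightarrow> 'a \<Rightarrow> complex) \<Rightarrow> nat \<Rightarrow> 'a \<Rightarrow> complex" where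
  "sqfree_ext X q \<omega> = (\<Prod>p\<in>prime_factors q. X p \<omega>)"

definition euler_prod :: "(nat \<Rightarrow> 'a \<Rightarrow> complex) \<Rightarrow> 'a \<Rightarrow> complex" where
  "euler_prod X \<omega> = prodinf (on_primes (\<lambda>p. 1 + X p \<omega>))"

end

theory Submission
  imports Defs
begin

text \<open>
  Expanding the partial products gives, for any complex sequence \<open>a\<close> on the primes, the identity
  \<open>\<Prod>\<^sub>p (1 + a\<^sub>p) = \<Sum> a\<^sub>q\<close> over squarefree \<open>q\<close>, where one side converges absolutely iff the other does.
  Both infinite products are thus replaced by sums; for the expectations of \<open>Y\<close>, independence gives
  \<open>\<Prod>\<^bsub>p | q\<^esub> E(Y\<^sub>p) = E(Y\<^sub>q)\<close>. Splitting the two sums at \<open>x\<close> and bounding the tail of the first by \<open>R(x)\<close>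
  yields the claim. Taking \<open>x = 1/2\<close> in the hypothesis on \<open>R\<close> covers all squarefree numbers, which
  gives the integrability statements.
\<close>

section \<open>Squarefree numbers as finite sets of primes\<close>

lemma prod_prime_factors_squarefree:
  fixes q :: nat
  assumes "squarefree q"
  shows "\<Prod>(prime_factors q) = q"
proof -
  have nz: "q \<noteq> 0"
    using assms by (metis not_squarefree_0)
  have "q = (\<Prod>p\<in>prime_factors q. p ^ multiplicity p q)"
    using nz by (intro prime_factorization_nat) simp
  \<comment> \<open>Every prime factor of a squarefree number has multiplicity one.\<close>
  also have "\<dots> = \<Prod>(prime_factors q)"
    using assms squarefree_factorial_semiring'[OF nz] by (intro prod.cong) auto
  finally show ?thesis by simp
qed

text \<open>The inverse map sends a set of primes to its product. This turns a sum over subsets of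
  \<open>P\<close>, as produced by expanding a finite product, into a sum over squarefree
  numbers.\<close>

lemma bij_betw_prime_factors_squarefree:
  fixes P :: "nat set"
  assumes "finite P" "\<And>p. p \<in> P \<Longrightarrow> prime p"
  shows "bij_betw prime_factors {q. squarefree q \<and> prime_factors q \<subseteq> P} (Pow P)"
proof (rule bij_betw_byWitness[where f' = "\<lambda>S. \<Prod>S"])
  have fin: "finite S" if "S \<subseteq> P" for S
    using that assms(1) by (rule finite_subset)
  have pf: "prime_factors (\<Prod>S) = S" if "S \<subseteq> P" for S
  proof -
    have "prime_factors (\<Prod>S) = \<Union>((prime_factors \<circ> (\<lambda>p. p)) ` S)"
      using that assms(2) fin[OF that] by (intro prime_factors_prod) (auto dest: prime_gt_0_nat)
    also have "\<dots> = (\<Union>p\<in>S. {p})"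
      unfolding o_def using that assms(2) by (intro SUP_cong prime_prime_factors) auto
    finally show ?thesis by simp
  qed
  have sf: "squarefree (\<Prod>S)" if "S \<subseteq> P" for S
    using that assms(2)
    by (intro squarefree_prod_coprime) (auto simp: primes_coprime squarefree_prime subset_iff)
  show "\<forall>q\<in>{q. squarefree q \<and> prime_factors q \<subseteq> P}. \<Prod>(prime_factors q) = q"
    by (auto simp: prod_prime_factors_squarefree)
  show "\<forall>S\<in>Pow P. prime_factors (\<Prod>S) = S"
    using pf by auto
  show "prime_factors ` {q. squarefree q \<and> prime_factors q \<subseteq> P} \<subseteq> Pow P"
    by auto
  show "(\<lambda>S. \<Prod>S) ` Pow P \<subseteq> {q. squarefree q \<and> prime_factors q \<subseteq> P}"
    using sf pf by auto
qed

text \<open>Bounding the prime factors instead of \<open>q\<close> itself yields exactly the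
  squarefree numbers that occur in the partial product up to \<open>n\<close>; the bijection with a
  finite power set makes this index set finite.\<close>

lemma
  fixes n :: nat
  shows bij_betw_prime_factors_atMost:
      "bij_betw prime_factors {q. squarefree q \<and> prime_factors q \<subseteq> {..n}} (Pow {p\<in>{..n}. prime p})"
    and finite_squarefree_prime_factors_atMost:
      "finite {q. squarefree q \<and> prime_factors q \<subseteq> {..n}}"
proof -
  have eq: "{q. squarefree q \<and> prime_factors q \<subseteq> {..n}} =
      {q. squarefree q \<and> prime_factors q \<subseteq> {p\<in>{..n}. prime p}}"
    by auto
  show "bij_betw prime_factors {q. squarefree q \<and> prime_factors q \<subseteq> {..n}} (Pow {p\<in>{..n}. prime p})"
    unfolding eq by (rule bij_betw_prime_factors_squarefree) auto
  then show "finite {q. squarefree q \<and> prime_factors q \<subseteq> {..n}}"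
    by (simp add: bij_betw_finite)
qed

section \<open>Euler products as sums over squarefree numbers\<close>

lemma prod_on_primes_atMost:
  fixes a :: "nat \<Rightarrow> 'b::comm_semiring_1"
  shows "(\<Prod>i\<le>n. on_primes (\<lambda>p. 1 + a p) i) =
    (\<Sum>q\<in>{q. squarefree q \<and> prime_factors q \<subseteq> {..n}}. \<Prod>p\<in>prime_factors q. a p)"
proof -
  have "(\<Prod>i\<le>n. on_primes (\<lambda>p. 1 + a p) i) = (\<Prod>p\<in>{p\<in>{..n}. prime p}. a p + 1)"
    unfolding on_primes_def by (subst prod.inter_filter) (auto intro: prod.cong simp: add.commute)
  also have "\<dots> = (\<Sum>S\<in>Pow {p\<in>{..n}. prime p}. \<Prod>p\<in>S. a p)"
    by (subst prod_add) auto
  also have "\<dots> = (\<Sum>q\<in>{q. squarefree q \<and> prime_factors q \<subseteq> {..n}}. \<Prod>p\<in>prime_factors q. a p)"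
    by (rule sum.reindex_bij_betw[OF bij_betw_prime_factors_atMost, symmetric])
  finally show ?thesis .
qed

text \<open>Infinite sums are limits along finite subsets ordered by inclusion. The index sets of
  the partial products eventually contain any given finite set of squarefree numbers, so the limit
  can be taken along them.\<close>

lemma filterlim_squarefree_prime_factors_atMost:
  "filterlim (\<lambda>n::nat. {q. squarefree q \<and> prime_factors q \<subseteq> {..n}})
    (finite_subsets_at_top {q. squarefree q}) sequentially"
  unfolding filterlim_finite_subsets_at_top
proof (intro allI impI)
  fix F :: "nat set"
  assume F: "finite F \<and> F \<subseteq> {q. squarefree q}"
  \<comment> \<open>Inserting \<open>0\<close> keeps \<open>Max\<close> meaningful when no element
    of \<open>F\<close> has a prime factor, as for \<open>F = {}\<close> or
    \<open>F = {1}\<close>.\<close>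
  define N where "N = Max (insert 0 (\<Union>q\<in>F. prime_factors q))"
  have "p \<le> N" if "q \<in> F" "p \<in> prime_factors q" for p q
    unfolding N_def using F that by (intro Max_ge) auto
  then have "F \<subseteq> {q. squarefree q \<and> prime_factors q \<subseteq> {..n}}" if "n \<ge> N" for n
    using F that by fastforce
  then show "\<forall>\<^sub>F n in sequentially. finite {q. squarefree q \<and> prime_factors q \<subseteq> {..n}} \<and>
      F \<subseteq> {q. squarefree q \<and> prime_factors q \<subseteq> {..n}} \<and>
      {q. squarefree q \<and> prime_factors q \<subseteq> {..n}} \<subseteq> {q. squarefree q}"
    using finite_squarefree_prime_factors_atMost
    by (intro eventually_sequentiallyI[of N]) auto
qed

text \<open>Absolute convergence of a product is by definition convergence of the product of
  \<open>1 + norm (f i - 1)\<close>, and at non-primes this factor is 1.\<close>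

lemma abs_convergent_prod_on_primes_iff:
  fixes a :: "nat \<Rightarrow> 'b::real_normed_field"
  shows "abs_convergent_prod (on_primes (\<lambda>p. 1 + a p)) \<longleftrightarrow>
    convergent_prod (on_primes (\<lambda>p. 1 + norm (a p)))"
proof -
  have "(\<lambda>i. 1 + norm (on_primes (\<lambda>p. 1 + a p) i - 1)) = on_primes (\<lambda>p. 1 + norm (a p))"
    by (auto simp: on_primes_def)
  then show ?thesis
    by (simp add: abs_convergent_prod_def)
qed

text \<open>The partial products of \<open>1 + norm (a p)\<close> have factors at least 1 and are
  finite subsums of the series of norms. A summable series therefore bounds them, which forces
  convergence; conversely, each finite subsum is at most some partial product, hence at most the
  infinite product.\<close>

lemma abs_convergent_prod_on_primes_iff_summable_squarefree:
  fixes a :: "nat \<Rightarrow> 'b::real_normed_field"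
  shows "abs_convergent_prod (on_primes (\<lambda>p. 1 + a p)) \<longleftrightarrow>
    (\<lambda>q. norm (\<Prod>p\<in>prime_factors q. a p)) summable_on {q. squarefree q}"
    (is "?conv \<longleftrightarrow> ?sum")
proof
  let ?A = "\<lambda>n::nat. {q. squarefree q \<and> prime_factors q \<subseteq> {..n}}"
  let ?g = "on_primes (\<lambda>p. 1 + norm (a p))"
  have part: "(\<Prod>i\<le>n. ?g i) = (\<Sum>q\<in>?A n. norm (\<Prod>p\<in>prime_factors q. a p))" for n
    by (simp add: prod_on_primes_atMost prod_norm)
  have ge1: "?g i \<ge> 1" for i
    by (simp add: on_primes_def)
  show ?conv if ?sum
  proof -
    have "(\<Prod>i\<le>n. ?g i) \<le> (\<Sum>\<^sub>\<infinity>q\<in>{q. squarefree q}. norm (\<Prod>p\<in>prime_factors q. a p))" for n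
      unfolding part using that finite_squarefree_prime_factors_atMost
      by (intro finite_sum_le_infsum) auto
    with ge1 show ?thesis
      unfolding abs_convergent_prod_on_primes_iff by (rule bounded_imp_convergent_prod)
  qed
  show ?sum if ?conv
  proof (rule nonneg_bdd_above_summable_on)
    have bound: "(\<Sum>q\<in>F. norm (\<Prod>p\<in>prime_factors q. a p)) \<le> prodinf ?g"
      if F: "F \<in> {F. F \<subseteq> {q. squarefree q} \<and> finite F}" for F
    proof -
      have "\<forall>\<^sub>F n in sequentially. F \<subseteq> ?A n"
        using filterlim_squarefree_prime_factors_atMost[unfolded filterlim_finite_subsets_at_top,
          rule_format, of F] F
        by (auto elim!: eventually_mono)
      then obtain n where n: "F \<subseteq> ?A n"
        by (auto simp: eventually_sequentially)
      have "(\<Sum>q\<in>F. norm (\<Prod>p\<in>prime_factors q. a p)) \<le> (\<Prod>i\<le>n. ?g i)"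
        unfolding part using n finite_squarefree_prime_factors_atMost by (intro sum_mono2) auto
      also have "\<dots> \<le> prodinf ?g"
        \<comment> \<open>\<open>prod_le_prodinf\<close> concerns products over
          \<open>i < n\<close>, so the range \<open>..n\<close> is read as
          \<open>..<Suc n\<close>.\<close>
        unfolding lessThan_Suc_atMost[symmetric]
      proof (rule prod_le_prodinf)
        show "?g has_prod prodinf ?g"
          using \<open>?conv\<close> by (simp add: abs_convergent_prod_on_primes_iff convergent_prod_has_prod)
      qed (rule order_trans[OF zero_le_one ge1] ge1)+
      finally show ?thesis .
    qed
    then show "bdd_above (sum (\<lambda>q. norm (\<Prod>p\<in>prime_factors q. a p)) ` {F. F \<subseteq> {q. squarefree q} \<and> finite F})"
      by (rule bdd_aboveI2)
  qed simp
qed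

text \<open>Both sides are limits of the same partial products; absolute convergence is what makes
  the series summable.\<close>

lemma prodinf_on_primes_eq_infsum_squarefree:
  fixes a :: "nat \<Rightarrow> complex"
  assumes "abs_convergent_prod (on_primes (\<lambda>p. 1 + a p))"
  shows "prodinf (on_primes (\<lambda>p. 1 + a p)) = (\<Sum>\<^sub>\<infinity>q\<in>{q. squarefree q}. \<Prod>p\<in>prime_factors q. a p)"
proof (rule LIMSEQ_unique)
  show "(\<lambda>n. \<Prod>i\<le>n. on_primes (\<lambda>p. 1 + a p) i) \<longlonglongrightarrow> prodinf (on_primes (\<lambda>p. 1 + a p))"
    using assms by (intro convergent_prod_LIMSEQ abs_convergent_prod_imp_convergent_prod)
  have "(\<lambda>q. \<Prod>p\<in>prime_factors q. a p) summable_on {q. squarefree q}"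
    using assms
    by (simp add: abs_summable_summable abs_convergent_prod_on_primes_iff_summable_squarefree)
  then have "(sum (\<lambda>q. \<Prod>p\<in>prime_factors q. a p) \<longlongrightarrow>
      (\<Sum>\<^sub>\<infinity>q\<in>{q. squarefree q}. \<Prod>p\<in>prime_factors q. a p)) (finite_subsets_at_top {q. squarefree q})"
    using has_sum_infsum by (simp add: has_sum_def)
  from filterlim_compose[OF this filterlim_squarefree_prime_factors_atMost]
  show "(\<lambda>n. \<Prod>i\<le>n. on_primes (\<lambda>p. 1 + a p) i) \<longlonglongrightarrow>
      (\<Sum>\<^sub>\<infinity>q\<in>{q. squarefree q}. \<Prod>p\<in>prime_factors q. a p)"
    by (simp add: prod_on_primes_atMost)
qed

text \<open>Almost sure convergence alone does not settle measurability, since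
  \<open>prodinf\<close> also has a value where the product diverges. The set of convergence is
  measurable, and off it that value is constant.\<close>

lemma borel_measurable_prodinf:
  fixes f :: "nat \<Rightarrow> 'a \<Rightarrow> 'b::{real_normed_field, banach, second_countable_topology}"
  assumes [measurable]: "\<And>i. f i \<in> borel_measurable M"
  shows "(\<lambda>\<omega>. prodinf (\<lambda>i. f i \<omega>)) \<in> borel_measurable M"
proof -
  \<comment> \<open>By completeness, convergence becomes a countable union over \<open>m\<close> of
    conditions built from \<open>Cauchy\<close> and \<open>lim\<close>, both measurable for
    sequences of measurable functions.\<close>
  have conv: "convergent_prod g \<longleftrightarrow>
      (\<exists>m. Cauchy (\<lambda>n. \<Prod>i\<le>n. g (i + m)) \<and> lim (\<lambda>n. \<Prod>i\<le>n. g (i + m)) \<noteq> 0)" for g :: "nat \<Rightarrow> 'b"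
    unfolding convergent_prod_def raw_has_prod_def Cauchy_convergent_iff convergent_LIMSEQ_iff
    by (metis limI)
  \<comment> \<open>For a divergent product the definite description has an unsatisfiable predicate,
    so its default value does not depend on \<open>g\<close>.\<close>
  have "prodinf g = (if convergent_prod g then lim (\<lambda>n. \<Prod>i\<le>n. g i) else (THE p. False))"
    for g :: "nat \<Rightarrow> 'b"
  proof (cases "convergent_prod g")
    case True
    then show ?thesis
      using convergent_prod_LIMSEQ limI by fastforce
  next
    case False
    then have "(\<lambda>p. g has_prod p) = (\<lambda>_. False)"
      by (auto simp: has_prod_iff)
    with False show ?thesis
      by (simp add: prodinf_def)
  qed
  then show ?thesis
    unfolding conv by simp
qed

theorem proposition2p1:
  fixes M :: "'a measure"
    and X Y :: "nat \<Rightarrow> 'a \<Rightarrow> complex"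
    and R :: "real \<Rightarrow> 'a \<Rightarrow> real"
  assumes "prob_space M"
    and X_rv: "\<And>p. prime p \<Longrightarrow> X p \<in> borel_measurable M"
    and Y_indep: "prob_space.indep_vars M (\<lambda>_. borel) Y {p. prime p}"
    and Y_int: "\<And>p. prime p \<Longrightarrow> integrable M (Y p)"
    and R_int: "\<And>x. x > 0 \<Longrightarrow> integrable M (R x)"
    and R_nonneg: "\<And>x \<omega>. x > 0 \<Longrightarrow> \<omega> \<in> space M \<Longrightarrow> 0 \<le> R x \<omega>"
    and R_bound: "\<And>x. x > 0 \<Longrightarrow>
      AE \<omega> in M. (\<lambda>q. cmod (sqfree_ext X q \<omega>)) summable_on {q. squarefree q \<and> real q > x} \<and>
        (\<Sum>\<^sub>\<infinity>q\<in>{q. squarefree q \<and> real q > x}. cmod (sqfree_ext X q \<omega>)) \<le> R x \<omega>"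
    and R_lim: "AE \<omega> in M. ((\<lambda>x. R x \<omega>) \<longlongrightarrow> 0) at_top"
    and EY_conv: "convergent_prod (on_primes (\<lambda>p. 1 + cmod (\<integral>\<omega>. Y p \<omega> \<partial>M)))"
  shows "(AE \<omega> in M. abs_convergent_prod (on_primes (\<lambda>p. 1 + X p \<omega>))) \<and>
    integrable M (euler_prod X) \<and>
    abs_convergent_prod (on_primes (\<lambda>p. 1 + (\<integral>\<omega>. Y p \<omega> \<partial>M))) \<and>
    (\<forall>q. squarefree q \<longrightarrow> integrable M (sqfree_ext X q) \<and> integrable M (sqfree_ext Y q)) \<and>
    (\<lambda>q. cmod (\<integral>\<omega>. sqfree_ext Y q \<omega> \<partial>M)) summable_on {q. squarefree q} \<and>
    (\<forall>x>0.
      cmod ((\<integral>\<omega>. euler_prod X \<omega> \<partial>M) - prodinf (on_primes (\<lambda>p. 1 + (\<integral>\<omega>. Y p \<omega> \<partial>M))))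
      \<le> (\<integral>\<omega>. R x \<omega> \<partial>M)
        + (\<Sum>q\<in>{q. squarefree q \<and> real q \<le> x}.
             cmod (\<integral>\<omega>. sqfree_ext X q \<omega> - sqfree_ext Y q \<omega> \<partial>M))
        + (\<Sum>\<^sub>\<infinity>q\<in>{q. squarefree q \<and> real q > x}. cmod (\<integral>\<omega>. sqfree_ext Y q \<omega> \<partial>M)))"
proof -
  interpret prob_space M by fact
  let ?S = "{q::nat. squarefree q}"
  let ?L = "\<lambda>x. {q::nat. squarefree q \<and> real q \<le> x}"
  let ?U = "\<lambda>x. {q::nat. squarefree q \<and> real q > x}"
  \<comment> \<open>\<open>0\<close> is not squarefree, so squarefree numbers are at least
    1.\<close>
  have "real q > 1/2" if "squarefree q" for q :: nat
    using that by (cases q) auto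
  then have S_eq: "?U (1/2) = ?S"
    by auto
  have split: "?S = ?L x \<union> ?U x" "?L x \<inter> ?U x = {}" for x
    by auto
  have fin_L: "finite (?L x)" for x
    by (rule finite_subset[of _ "{..nat \<lfloor>x\<rfloor>}"]) (auto simp: le_nat_floor)
  have infsum_split: "infsum f ?S = sum f (?L x) + infsum f (?U x)" if "f summable_on ?S"
    for f :: "nat \<Rightarrow> complex" and x
  proof -
    have "infsum f (?L x \<union> ?U x) = infsum f (?L x) + infsum f (?U x)"
      using that fin_L by (intro infsum_Un_disjoint) (auto intro: summable_on_subset)
    then show ?thesis
      using fin_L by (simp flip: split)
  qed

  \<comment> \<open>Integrability of the random product and its tails\<close>
  have X_meas: "sqfree_ext X q \<in> borel_measurable M" for q
    using X_rv unfolding sqfree_ext_def[abs_def] by (intro borel_measurable_prod) auto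
  have X_ae: "AE \<omega> in M. (\<lambda>q. cmod (sqfree_ext X q \<omega>)) summable_on ?S \<and>
      (\<Sum>\<^sub>\<infinity>q\<in>?S. cmod (sqfree_ext X q \<omega>)) \<le> R (1/2) \<omega>"
    using R_bound[of "1/2"] unfolding S_eq by simp
  have X_prod: "AE \<omega> in M. abs_convergent_prod (on_primes (\<lambda>p. 1 + X p \<omega>))"
    using X_ae
    by eventually_elim
      (simp add: abs_convergent_prod_on_primes_iff_summable_squarefree flip: sqfree_ext_def)
  have X_sum: "AE \<omega> in M. euler_prod X \<omega> = (\<Sum>\<^sub>\<infinity>q\<in>?S. sqfree_ext X q \<omega>)"
    using X_prod
    by eventually_elim
      (simp add: euler_prod_def sqfree_ext_def prodinf_on_primes_eq_infsum_squarefree)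
  \<comment> \<open>A single term is at most the whole sum of norms, which \<open>R (1/2)\<close>
    dominates.\<close>
  have X_int: "integrable M (sqfree_ext X q)" if "squarefree q" for q
  proof (rule Bochner_Integration.integrable_bound[OF R_int[of "1/2"] X_meas])
    show "AE \<omega> in M. norm (sqfree_ext X q \<omega>) \<le> norm (R (1/2) \<omega>)"
      using X_ae
    proof eventually_elim
      case (elim \<omega>)
      have "(\<Sum>q\<in>{q}. cmod (sqfree_ext X q \<omega>)) \<le> (\<Sum>\<^sub>\<infinity>q\<in>?S. cmod (sqfree_ext X q \<omega>))"
        using elim that by (intro finite_sum_le_infsum) auto
      with elim show ?case by (simp add: abs_if)
    qed
  qed simp
  have X_tail: "AE \<omega> in M. cmod (euler_prod X \<omega> - (\<Sum>q\<in>?L x. sqfree_ext X q \<omega>)) \<le> R x \<omega>"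
    if "x > 0" for x
    using X_sum X_ae R_bound[OF that]
  proof eventually_elim
    case (elim \<omega>)
    have "euler_prod X \<omega> - (\<Sum>q\<in>?L x. sqfree_ext X q \<omega>) = (\<Sum>\<^sub>\<infinity>q\<in>?U x. sqfree_ext X q \<omega>)"
      using elim infsum_split[OF abs_summable_summable, of "\<lambda>q. sqfree_ext X q \<omega>" x] by simp
    moreover have "cmod (\<Sum>\<^sub>\<infinity>q\<in>?U x. sqfree_ext X q \<omega>) \<le> (\<Sum>\<^sub>\<infinity>q\<in>?U x. cmod (sqfree_ext X q \<omega>))"
      using elim by (intro norm_infsum_bound) auto
    ultimately show ?case
      using elim by simp
  qed
  have Z_meas: "euler_prod X \<in> borel_measurable M"
    unfolding euler_prod_def[abs_def]
  proof (rule borel_measurable_prodinf)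
    show "(\<lambda>\<omega>. on_primes (\<lambda>p. 1 + X p \<omega>) i) \<in> borel_measurable M" for i
      using X_rv by (cases "prime i") (auto simp: on_primes_def)
  qed
  have Z_tail_int: "integrable M (\<lambda>\<omega>. euler_prod X \<omega> - (\<Sum>q\<in>?L x. sqfree_ext X q \<omega>))"
    if "x > 0" for x
  proof (rule Bochner_Integration.integrable_bound[OF R_int[OF that]])
    show "AE \<omega> in M. norm (euler_prod X \<omega> - (\<Sum>q\<in>?L x. sqfree_ext X q \<omega>)) \<le> norm (R x \<omega>)"
      using X_tail[OF that] by eventually_elim simp
  qed (use Z_meas X_meas in measurable)
  have sum_int: "integrable M (\<lambda>\<omega>. \<Sum>q\<in>?L x. sqfree_ext X q \<omega>)" for x
    using X_int by (intro Bochner_Integration.integrable_sum) auto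
  \<comment> \<open>The product is its tail beyond 1, dominated by \<open>R 1\<close>, plus a finite
    sum of integrable terms; any positive cut would serve.\<close>
  have Z_int: "integrable M (euler_prod X)"
    using Bochner_Integration.integrable_add[OF Z_tail_int[of 1] sum_int[of 1]] by simp

  \<comment> \<open>Expectations of the independent variables\<close>
  have Y_indep': "indep_vars (\<lambda>_. borel) Y (prime_factors q)" for q
    using Y_indep by (rule indep_vars_subset) auto
  have Y_sqfree_int: "integrable M (sqfree_ext Y q)" for q
    unfolding sqfree_ext_def[abs_def]
    using Y_int by (intro indep_vars_integrable[OF _ Y_indep']) auto
  have EY: "(\<integral>\<omega>. sqfree_ext Y q \<omega> \<partial>M) = (\<Prod>p\<in>prime_factors q. \<integral>\<omega>. Y p \<omega> \<partial>M)" for q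
    unfolding sqfree_ext_def
    using Y_int by (intro indep_vars_lebesgue_integral[OF _ Y_indep']) auto
  have Y_prod: "abs_convergent_prod (on_primes (\<lambda>p. 1 + (\<integral>\<omega>. Y p \<omega> \<partial>M)))"
    using EY_conv by (simp add: abs_convergent_prod_on_primes_iff)
  have EY_summable: "(\<lambda>q. cmod (\<integral>\<omega>. sqfree_ext Y q \<omega> \<partial>M)) summable_on ?S"
    unfolding EY using Y_prod by (simp add: abs_convergent_prod_on_primes_iff_summable_squarefree)

  \<comment> \<open>The inequality\<close>
  have main: "cmod ((\<integral>\<omega>. euler_prod X \<omega> \<partial>M) - prodinf (on_primes (\<lambda>p. 1 + (\<integral>\<omega>. Y p \<omega> \<partial>M))))
      \<le> (\<integral>\<omega>. R x \<omega> \<partial>M)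
        + (\<Sum>q\<in>?L x. cmod (\<integral>\<omega>. sqfree_ext X q \<omega> - sqfree_ext Y q \<omega> \<partial>M))
        + (\<Sum>\<^sub>\<infinity>q\<in>?U x. cmod (\<integral>\<omega>. sqfree_ext Y q \<omega> \<partial>M))" if x: "x > 0" for x
  proof -
    \<comment> \<open>The difference to be estimated is \<open>A + B - C\<close>: \<open>A\<close>
      is the expected tail of the random product, \<open>B\<close> compares the terms up to
      \<open>x\<close>, and \<open>C\<close> is the tail of the product of expectations. Each one is
      bounded by one summand of the claim.\<close>
    define A where "A = (\<integral>\<omega>. euler_prod X \<omega> - (\<Sum>q\<in>?L x. sqfree_ext X q \<omega>) \<partial>M)"
    define B where "B = (\<Sum>q\<in>?L x. \<integral>\<omega>. sqfree_ext X q \<omega> - sqfree_ext Y q \<omega> \<partial>M)"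
    define C where "C = (\<Sum>\<^sub>\<infinity>q\<in>?U x. \<integral>\<omega>. sqfree_ext Y q \<omega> \<partial>M)"
    have "A = (\<integral>\<omega>. euler_prod X \<omega> \<partial>M) - (\<Sum>q\<in>?L x. \<integral>\<omega>. sqfree_ext X q \<omega> \<partial>M)"
      unfolding A_def using Z_int sum_int X_int by (simp add: Bochner_Integration.integral_sum)
    moreover have "B = (\<Sum>q\<in>?L x. \<integral>\<omega>. sqfree_ext X q \<omega> \<partial>M) - (\<Sum>q\<in>?L x. \<integral>\<omega>. sqfree_ext Y q \<omega> \<partial>M)"
      unfolding B_def using X_int Y_sqfree_int by (simp flip: sum_subtractf)
    moreover have "prodinf (on_primes (\<lambda>p. 1 + (\<integral>\<omega>. Y p \<omega> \<partial>M))) =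
        (\<Sum>q\<in>?L x. \<integral>\<omega>. sqfree_ext Y q \<omega> \<partial>M) + C"
      unfolding C_def prodinf_on_primes_eq_infsum_squarefree[OF Y_prod] EY[symmetric]
      using EY_summable by (rule infsum_split[OF abs_summable_summable])
    ultimately have eq: "(\<integral>\<omega>. euler_prod X \<omega> \<partial>M) - prodinf (on_primes (\<lambda>p. 1 + (\<integral>\<omega>. Y p \<omega> \<partial>M))) = A + B - C"
      by simp
    have "cmod (A + B - C) \<le> cmod A + cmod B + cmod C"
      using norm_triangle_ineq4[of "A + B" C] norm_triangle_ineq[of A B] by linarith
    moreover have "cmod A \<le> (\<integral>\<omega>. R x \<omega> \<partial>M)"
      unfolding A_def using X_tail[OF x] Z_tail_int[OF x] R_int[OF x]
      by (intro order_trans[OF integral_norm_bound] integral_mono_AE integrable_norm)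
    moreover have "cmod B \<le> (\<Sum>q\<in>?L x. cmod (\<integral>\<omega>. sqfree_ext X q \<omega> - sqfree_ext Y q \<omega> \<partial>M))"
      unfolding B_def by (rule norm_sum)
    moreover have "cmod C \<le> (\<Sum>\<^sub>\<infinity>q\<in>?U x. cmod (\<integral>\<omega>. sqfree_ext Y q \<omega> \<partial>M))"
      unfolding C_def by (intro norm_infsum_bound summable_on_subset[OF EY_summable]) auto
    ultimately show ?thesis
      unfolding eq by linarith
  qed
  show ?thesis
    by (intro conjI allI impI X_prod Z_int Y_prod X_int Y_sqfree_int EY_summable main)
qed

end
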